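(* Let $\alpha : I \subset \mathbb{R} \to \mathbb{E}^4$ be a unit speed curve with nonzero curvatures $k_i$ ($i=1,2,3$) according to the parallel transport frame $\{T, M_1, M_2, M_3\}$ in $\mathbb{E}^4$. Then $\alpha$ is a rectifying curve if and only if there are constants $c_2, c_3 \in \mathbb{R}$ such that $c_2 k_2 + c_3 k_3 + 1 = 0$ along $\alpha$.
   Context: $\mathbb{E}^4$ is $\mathbb{R}^4$ with the standard inner product $\langle\cdot,\cdot\rangle$; primes denote derivatives with respect to the arclength parameter $s$, and curves are sufficiently differentiable. A vector field along a unit speed curve $\alpha$ that is perpendicular to $T=\alpha'$ is called relatively parallel if its derivative is tangential (a multiple of $T$) along $\alpha$. A parallel transport frame of $\alpha$ is an orthonormal frame $\{T, M_1, M_2, M_3\}$ along $\alpha$ with $T=\alpha'$ and $M_1, M_2, M_3$ relatively parallel; its curvatures are $k_i = \langle T', M_i\rangle$, so that $T' = k_1M_1+k_2M_2+k_3M_3$ and $M_i' = -k_iT$ for $i=1,2,3$. A rectifying curve (according to the parallel transport frame) is a curve whose position vector always lies in its rectifying space $M_1^\perp = \{X\in\mathbb{E}^4 \mid \langle X, M_1\rangle = 0\}$, i.e. $\alpha(s) = c_1(s)T(s) + c_2(s)M_2(s) + c_3(s)M_3(s)$ for some differentiable functions $c_1,c_2,c_3$.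
   Formalization: Being rectifying depends on the origin, so the "if" part fails literally (a circle with curvatures (1,-1,1) has c_2=1, c_3=0 but <α,M_1>=-1/3); the formal statement says instead that α - p is a rectifying curve for some constant point p iff the constants c_2, c_3 exist. *)

theory Defs
  imports "HOL-Analysis.Analysis"
begin

text \<open>
  Derivatives are taken within the parameter interval \<open>I\<close>, so they are one-sided at endpoints
  that belong to \<open>I\<close>; on open intervals they are the ordinary ones.
\<close>

definition tangent :: "real set \<Rightarrow> (real \<Rightarrow> real ^ 4) \<Rightarrow> real \<Rightarrow> real ^ 4" where
  "tangent I \<alpha> s = vector_derivative \<alpha> (at s within I)"

text \<open>
  Two derivatives are all the regularity that the curvatures \<open>k\<^sub>i = \<langle>T', M\<^sub>i\<rangle>\<close> need.
\<close>

definition unit_speed_curve :: "real set \<Rightarrow> (real \<Rightarrow> real ^ 4) \<Rightarrow> bool" where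
  "unit_speed_curve I \<alpha> \<longleftrightarrow>
     (\<forall>s\<in>I. \<alpha> differentiable (at s within I)) \<and>
     (\<forall>s\<in>I. tangent I \<alpha> differentiable (at s within I)) \<and>
     (\<forall>s\<in>I. norm (tangent I \<alpha> s) = 1)"

definition relatively_parallel ::
    "real set \<Rightarrow> (real \<Rightarrow> real ^ 4) \<Rightarrow> (real \<Rightarrow> real ^ 4) \<Rightarrow> bool" where
  "relatively_parallel I \<alpha> M \<longleftrightarrow>
     (\<forall>s\<in>I. M s \<bullet> tangent I \<alpha> s = 0 \<and>
            M differentiable (at s within I) \<and>
            (\<exists>c. vector_derivative M (at s within I) = c *\<^sub>R tangent I \<alpha> s))"

definition parallel_transport_frame ::
    "real set \<Rightarrow> (real \<Rightarrow> real ^ 4) \<Rightarrow> (real \<Rightarrow> real ^ 4) \<Rightarrow> (real \<Rightarrow> real ^ 4) \<Rightarrow>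
     (real \<Rightarrow> real ^ 4) \<Rightarrow> bool" where
  "parallel_transport_frame I \<alpha> M1 M2 M3 \<longleftrightarrow>
     (\<forall>s\<in>I. norm (tangent I \<alpha> s) = 1 \<and> norm (M1 s) = 1 \<and> norm (M2 s) = 1 \<and> norm (M3 s) = 1 \<and>
            tangent I \<alpha> s \<bullet> M1 s = 0 \<and> tangent I \<alpha> s \<bullet> M2 s = 0 \<and> tangent I \<alpha> s \<bullet> M3 s = 0 \<and>
            M1 s \<bullet> M2 s = 0 \<and> M1 s \<bullet> M3 s = 0 \<and> M2 s \<bullet> M3 s = 0) \<and>
     relatively_parallel I \<alpha> M1 \<and> relatively_parallel I \<alpha> M2 \<and> relatively_parallel I \<alpha> M3"

definition curvature ::
    "real set \<Rightarrow> (real \<Rightarrow> real ^ 4) \<Rightarrow> (real \<Rightarrow> real ^ 4) \<Rightarrow> real \<Rightarrow> real" where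
  "curvature I \<alpha> M s = vector_derivative (tangent I \<alpha>) (at s within I) \<bullet> M s"

definition rectifying_space :: "(real \<Rightarrow> real ^ 4) \<Rightarrow> real \<Rightarrow> (real ^ 4) set" where
  "rectifying_space M1 s = {X. X \<bullet> M1 s = 0}"

text \<open>
  Unlike the frame and the curvatures, this property depends on the choice of origin.  The circle
  of radius \<open>1 / sqrt 3\<close> centered at the origin has a frame with curvatures \<open>(1, -1, 1)\<close> for which
  \<open>\<langle>\<alpha>, M\<^sub>1\<rangle> = -1/3\<close>, although \<open>1 * k\<^sub>2 + 0 * k\<^sub>3 + 1 = 0\<close>.  Curvatures can therefore characterize
  rectifying curves only up to a translation \<open>\<alpha> - p\<close>, for which \<open>T\<close>, \<open>M\<^sub>i\<close> and \<open>k\<^sub>i\<close> are unchanged.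
\<close>

definition rectifying_curve ::
    "real set \<Rightarrow> (real \<Rightarrow> real ^ 4) \<Rightarrow> (real \<Rightarrow> real ^ 4) \<Rightarrow> (real \<Rightarrow> real ^ 4) \<Rightarrow>
     (real \<Rightarrow> real ^ 4) \<Rightarrow> bool" where
  "rectifying_curve I \<alpha> M1 M2 M3 \<longleftrightarrow>
     parallel_transport_frame I \<alpha> M1 M2 M3 \<and> (\<forall>s\<in>I. \<alpha> s \<in> rectifying_space M1 s)"

end

theory Submission
  imports Defs
begin

text \<open>
  Along a parallel transport frame \<open>\<langle>\<alpha> - p, M\<^sub>i\<rangle>' = -k\<^sub>i \<langle>\<alpha> - p, T\<rangle>\<close>.  If \<open>\<langle>\<alpha> - p, M\<^sub>1\<rangle> = 0\<close>,
  then \<open>k\<^sub>1 \<noteq> 0\<close> gives \<open>\<langle>\<alpha> - p, T\<rangle> = 0\<close>, so \<open>c\<^sub>i = \<langle>\<alpha> - p, M\<^sub>i\<rangle>\<close> is constant for \<open>i = 2, 3\<close>, and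
  differentiating \<open>\<langle>\<alpha> - p, T\<rangle> = 0\<close> once more yields \<open>1 + c\<^sub>2 k\<^sub>2 + c\<^sub>3 k\<^sub>3 = 0\<close>.  Conversely,
  \<open>(\<alpha> - c\<^sub>2 M\<^sub>2 - c\<^sub>3 M\<^sub>3)' = (1 + c\<^sub>2 k\<^sub>2 + c\<^sub>3 k\<^sub>3) T\<close>, so if this vanishes, then
  \<open>p = \<alpha> - c\<^sub>2 M\<^sub>2 - c\<^sub>3 M\<^sub>3\<close> is a constant point.
\<close>

text \<open>Makes derivatives within \<open>I\<close> unique, also at endpoints. A singleton has
  empty interior, so \<open>I\<close> is a connected set other than a singleton, and each of its
  points is a limit point.\<close>

lemma at_within_interval_neq_bot:
  fixes I :: "real set"
  assumes "is_interval I" "interior I \<noteq> {}" "s \<in> I"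
  shows "at s within I \<noteq> bot"
proof -
  have "I \<noteq> {a}" for a
    using assms(2) by auto
  then have "s islimpt I"
    using assms connected_imp_perfect is_interval_connected by blast
  then show ?thesis
    by (simp add: trivial_limit_within)
qed

lemma has_vector_derivative_inner:
  assumes "(f has_vector_derivative f') (at s within I)"
    and "(g has_vector_derivative g') (at s within I)"
  shows "((\<lambda>t. f t \<bullet> g t) has_vector_derivative (f s \<bullet> g' + f' \<bullet> g s)) (at s within I)"
  using bounded_bilinear.has_vector_derivative[OF bounded_bilinear_inner assms] .

text \<open>The product rule and constancy on \<open>I\<close> give two derivatives of the same
  function; they agree because the filter is nontrivial.\<close>

lemma inner_derivatives_of_const:
  assumes "at s within I \<noteq> bot" "s \<in> I"
    and "(f has_vector_derivative f') (at s within I)"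
    and "(g has_vector_derivative g') (at s within I)"
    and const: "\<And>t. t \<in> I \<Longrightarrow> f t \<bullet> g t = c"
  shows "f s \<bullet> g' + f' \<bullet> g s = 0"
proof -
  have "((\<lambda>t. f t \<bullet> g t) has_vector_derivative 0) (at s within I)"
    by (rule has_vector_derivative_transform[OF assms(2) _ has_vector_derivative_const[of c]])
      (simp add: const)
  then show ?thesis
    using has_vector_derivative_inner[OF assms(3,4)] assms(1)
    by (metis vector_derivative_within)
qed

text \<open>Nonzero pairwise orthogonal vectors are independent, and four of them span a space of
  dimension 4.\<close>

lemma orthonormal_expansion_4:
  fixes e1 e2 e3 e4 v :: "real ^ 4"
  assumes "norm e1 = 1" "norm e2 = 1" "norm e3 = 1" "norm e4 = 1"
    and "e1 \<bullet> e2 = 0" "e1 \<bullet> e3 = 0" "e1 \<bullet> e4 = 0" "e2 \<bullet> e3 = 0" "e2 \<bullet> e4 = 0" "e3 \<bullet> e4 = 0"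
  shows "v = (v \<bullet> e1) *\<^sub>R e1 + (v \<bullet> e2) *\<^sub>R e2 + (v \<bullet> e3) *\<^sub>R e3 + (v \<bullet> e4) *\<^sub>R e4"
proof -
  let ?B = "{e1, e2, e3, e4}"
  have sq: "e1 \<bullet> e1 = 1" "e2 \<bullet> e2 = 1" "e3 \<bullet> e3 = 1" "e4 \<bullet> e4 = 1"
    using assms(1-4) by (simp_all add: norm_eq_1)
  have distinct: "e1 \<noteq> e2" "e1 \<noteq> e3" "e1 \<noteq> e4" "e2 \<noteq> e3" "e2 \<noteq> e4" "e3 \<noteq> e4"
    using assms(5-10) sq by auto
  have "pairwise orthogonal ?B"
    using assms(5-10) by (auto simp: pairwise_insert orthogonal_def inner_commute)
  have "0 \<notin> ?B"
    using assms(1-4) by auto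
  then have "independent ?B"
    by (rule pairwise_orthogonal_independent[OF \<open>pairwise orthogonal ?B\<close>])
  moreover have "card ?B = 4"
    using distinct by simp
  ultimately have "UNIV \<subseteq> span ?B"
    by (intro card_ge_dim_independent) auto
  then have "(\<Sum>b\<in>?B. (v \<bullet> b) *\<^sub>R b) = v"
    using \<open>pairwise orthogonal ?B\<close> assms(1-4) by (intro orthonormal_basis_expand) auto
  then show ?thesis
    using distinct by (simp add: add.assoc)
qed

lemma has_vector_derivative_curve:
  assumes "unit_speed_curve I \<alpha>" "s \<in> I"
  shows "(\<alpha> has_vector_derivative tangent I \<alpha> s) (at s within I)"
  using assms unfolding unit_speed_curve_def tangent_def
  by (simp add: vector_derivative_works)

lemma has_vector_derivative_tangent:
  assumes "unit_speed_curve I \<alpha>" "s \<in> I"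
  shows "(tangent I \<alpha> has_vector_derivative vector_derivative (tangent I \<alpha>) (at s within I))
    (at s within I)"
  using assms unfolding unit_speed_curve_def
  by (simp add: vector_derivative_works)

text \<open>Relative parallelism only provides some multiple \<open>c\<close> of the tangent.
  Differentiating \<langle>M, T\<rangle> = 0 gives \<langle>M, T'\<rangle> + c = 0, which identifies
  \<open>c\<close>.\<close>

lemma has_vector_derivative_relatively_parallel:
  assumes "at s within I \<noteq> bot" "s \<in> I" "unit_speed_curve I \<alpha>" "relatively_parallel I \<alpha> M"
  shows "(M has_vector_derivative - curvature I \<alpha> M s *\<^sub>R tangent I \<alpha> s) (at s within I)"
proof -
  obtain c where "vector_derivative M (at s within I) = c *\<^sub>R tangent I \<alpha> s"
    and "M differentiable (at s within I)"
    using assms(2,4) unfolding relatively_parallel_def by blast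
  then have M: "(M has_vector_derivative c *\<^sub>R tangent I \<alpha> s) (at s within I)"
    by (metis vector_derivative_works)
  have "M s \<bullet> vector_derivative (tangent I \<alpha>) (at s within I)
      + (c *\<^sub>R tangent I \<alpha> s) \<bullet> tangent I \<alpha> s = 0"
    using assms(4) unfolding relatively_parallel_def
    by (intro inner_derivatives_of_const[OF assms(1,2) M
          has_vector_derivative_tangent[OF assms(3,2)]]) blast
  moreover have "tangent I \<alpha> s \<bullet> tangent I \<alpha> s = 1"
    using assms(2,3) by (simp add: unit_speed_curve_def norm_eq_1)
  ultimately have "c = - curvature I \<alpha> M s"
    by (simp add: curvature_def inner_commute)
  then show ?thesis
    using M by simp
qed

lemma tangent_translate:
  assumes "at s within I \<noteq> bot" "s \<in> I" "unit_speed_curve I \<alpha>"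
  shows "tangent I (\<lambda>t. \<alpha> t - p) s = tangent I \<alpha> s"
proof -
  have "((\<lambda>t. \<alpha> t - p) has_vector_derivative tangent I \<alpha> s) (at s within I)"
    unfolding has_vector_derivative_diff_const
    using has_vector_derivative_curve[OF assms(3,2)] .
  then show ?thesis
    unfolding tangent_def[of I "\<lambda>t. \<alpha> t - p"] using assms(1) by (simp add: vector_derivative_within)
qed

text \<open>The frame conditions see the curve only through its tangent on \<open>I\<close>, so they
  survive translation.\<close>

lemma parallel_transport_frame_cong:
  assumes "\<And>s. s \<in> I \<Longrightarrow> tangent I \<beta> s = tangent I \<alpha> s"
  shows "parallel_transport_frame I \<beta> M1 M2 M3 \<longleftrightarrow> parallel_transport_frame I \<alpha> M1 M2 M3"
  using assms by (simp add: parallel_transport_frame_def relatively_parallel_def)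

theorem theorem4:
  fixes I :: "real set" and \<alpha> M1 M2 M3 :: "real \<Rightarrow> real ^ 4"
  assumes "is_interval I" and "interior I \<noteq> {}"
    and "unit_speed_curve I \<alpha>"
    and "parallel_transport_frame I \<alpha> M1 M2 M3"
    and "\<forall>s\<in>I. curvature I \<alpha> M1 s \<noteq> 0 \<and> curvature I \<alpha> M2 s \<noteq> 0 \<and> curvature I \<alpha> M3 s \<noteq> 0"
  shows "(\<exists>p. rectifying_curve I (\<lambda>s. \<alpha> s - p) M1 M2 M3) \<longleftrightarrow>
         (\<exists>c2 c3. \<forall>s\<in>I. c2 * curvature I \<alpha> M2 s + c3 * curvature I \<alpha> M3 s + 1 = 0)"
proof -
  let ?T = "tangent I \<alpha>"
  let ?T' = "\<lambda>s. vector_derivative ?T (at s within I)"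
  let ?k = "curvature I \<alpha>"
  note frame = assms(4)[unfolded parallel_transport_frame_def]
  have nt: "at s within I \<noteq> bot" if "s \<in> I" for s
    using at_within_interval_neq_bot assms(1,2) that by blast
  have "convex I"
    using assms(1) is_interval_convex by blast
  have rp: "relatively_parallel I \<alpha> M1" "relatively_parallel I \<alpha> M2" "relatively_parallel I \<alpha> M3"
    using frame by blast+
  have M': "(M has_vector_derivative - ?k M s *\<^sub>R ?T s) (at s within I)"
    if "relatively_parallel I \<alpha> M" "s \<in> I" for M s
    using has_vector_derivative_relatively_parallel nt assms(3) that by blast
  have T': "(?T has_vector_derivative ?T' s) (at s within I)" if "s \<in> I" for s
    using has_vector_derivative_tangent assms(3) that by blast
  have TT: "?T s \<bullet> ?T s = 1" if "s \<in> I" for s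
    using frame that by (simp add: norm_eq_1)
  \<comment> \<open>As the frame condition is invariant under translation, only the position
    condition depends on \<open>p\<close>.\<close>
  have translate: "(\<forall>s\<in>I. (\<alpha> s - p) \<bullet> M1 s = 0) \<longleftrightarrow>
      rectifying_curve I (\<lambda>s. \<alpha> s - p) M1 M2 M3" for p
    using parallel_transport_frame_cong[OF tangent_translate[OF nt _ assms(3)]] assms(4)
    by (simp add: rectifying_curve_def rectifying_space_def)
  show ?thesis
  proof
    assume "\<exists>p. rectifying_curve I (\<lambda>s. \<alpha> s - p) M1 M2 M3"
    then obtain p where p: "(\<alpha> s - p) \<bullet> M1 s = 0" if "s \<in> I" for s
      using translate by blast
    let ?\<beta> = "\<lambda>s. \<alpha> s - p"
    have \<beta>': "(?\<beta> has_vector_derivative ?T s) (at s within I)" if "s \<in> I" for s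
      unfolding has_vector_derivative_diff_const
      using has_vector_derivative_curve[OF assms(3) that] .
    have \<beta>T: "?\<beta> s \<bullet> ?T s = 0" if "s \<in> I" for s
    proof -
      \<comment> \<open>The second summand vanishes by orthogonality, and then the nonzero factor
        \<open>?k M1 s\<close> can be cancelled.\<close>
      have "?\<beta> s \<bullet> (- ?k M1 s *\<^sub>R ?T s) + ?T s \<bullet> M1 s = 0"
        using inner_derivatives_of_const[OF nt[OF that] that \<beta>'[OF that] M'[OF rp(1) that] p] .
      then show ?thesis
        using frame assms(5) that by simp
    qed
    have const: "\<exists>c. \<forall>s\<in>I. ?\<beta> s \<bullet> M s = c" if M: "relatively_parallel I \<alpha> M" for M
    proof -
      \<comment> \<open>Both terms of the product rule vanish: one contains
        \<open>?\<beta> s \<bullet> ?T s\<close>, the other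
        \<open>?T s \<bullet> M s\<close>.\<close>
      have "((\<lambda>s. ?\<beta> s \<bullet> M s) has_vector_derivative 0) (at s within I)" if "s \<in> I" for s
        using has_vector_derivative_inner[OF \<beta>'[OF that] M'[OF M that]] \<beta>T[OF that] M that
        by (simp add: relatively_parallel_def inner_commute)
      then show ?thesis
        by (rule has_vector_derivative_zero_constant[OF \<open>convex I\<close>]) auto
    qed
    obtain c2 where c2: "?\<beta> s \<bullet> M2 s = c2" if "s \<in> I" for s
      using const[OF rp(2)] by blast
    obtain c3 where c3: "?\<beta> s \<bullet> M3 s = c3" if "s \<in> I" for s
      using const[OF rp(3)] by blast
    have "c2 * ?k M2 s + c3 * ?k M3 s + 1 = 0" if s: "s \<in> I" for s
    proof -
      \<comment> \<open>The tangential and \<open>M1\<close> coefficients are zero, so only the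
        constant coefficients \<open>c2\<close> and \<open>c3\<close> remain; pairing with
        \<open>?T' s\<close> then turns them into the curvature terms.\<close>
      have "?\<beta> s = (?\<beta> s \<bullet> ?T s) *\<^sub>R ?T s + (?\<beta> s \<bullet> M1 s) *\<^sub>R M1 s
          + (?\<beta> s \<bullet> M2 s) *\<^sub>R M2 s + (?\<beta> s \<bullet> M3 s) *\<^sub>R M3 s"
        using frame s by (intro orthonormal_expansion_4) auto
      then have "?\<beta> s = c2 *\<^sub>R M2 s + c3 *\<^sub>R M3 s"
        by (simp only: \<beta>T[OF s] p[OF s] c2[OF s] c3[OF s]) simp
      moreover have "?\<beta> s \<bullet> ?T' s + ?T s \<bullet> ?T s = 0"
        using inner_derivatives_of_const[OF nt[OF s] s \<beta>'[OF s] T'[OF s] \<beta>T] .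
      ultimately show ?thesis
        using TT[OF s] by (simp add: curvature_def inner_add_left inner_add_right inner_commute)
    qed
    then show "\<exists>c2 c3. \<forall>s\<in>I. c2 * ?k M2 s + c3 * ?k M3 s + 1 = 0"
      by blast
  next
    assume "\<exists>c2 c3. \<forall>s\<in>I. c2 * ?k M2 s + c3 * ?k M3 s + 1 = 0"
    then obtain c2 c3 where c: "c2 * ?k M2 s + c3 * ?k M3 s + 1 = 0" if "s \<in> I" for s
      by blast
    let ?p = "\<lambda>s. \<alpha> s - c2 *\<^sub>R M2 s - c3 *\<^sub>R M3 s"
    have "(?p has_vector_derivative 0) (at s within I)" if s: "s \<in> I" for s
    proof -
      have "(?p has_vector_derivative
          ?T s - c2 *\<^sub>R (- ?k M2 s *\<^sub>R ?T s) - c3 *\<^sub>R (- ?k M3 s *\<^sub>R ?T s)) (at s within I)"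
        by (intro has_vector_derivative_diff has_vector_derivative_curve[OF assms(3) s]
            bounded_linear.has_vector_derivative[OF bounded_linear_scaleR_right]
            M'[OF rp(2) s] M'[OF rp(3) s])
      moreover have "?T s - c2 *\<^sub>R (- ?k M2 s *\<^sub>R ?T s) - c3 *\<^sub>R (- ?k M3 s *\<^sub>R ?T s)
          = (c2 * ?k M2 s + c3 * ?k M3 s + 1) *\<^sub>R ?T s"
        by (simp add: algebra_simps)
      ultimately show ?thesis
        using c[OF s] by simp
    qed
    \<comment> \<open>Convexity of \<open>I\<close> yields a single point \<open>p\<close> for the
      whole curve; it serves as the new origin.\<close>
    then have "\<exists>p. \<forall>s\<in>I. ?p s = p"
      by (rule has_vector_derivative_zero_constant[OF \<open>convex I\<close>]) auto
    then obtain p where p: "?p s = p" if "s \<in> I" for s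
      by blast
    have "(\<alpha> s - p) \<bullet> M1 s = 0" if "s \<in> I" for s
    proof -
      \<comment> \<open>Seen from \<open>p\<close>, the curve lies in the span of
        \<open>M2 s\<close> and \<open>M3 s\<close>, which is orthogonal to
        \<open>M1 s\<close>.\<close>
      have "\<alpha> s - p = c2 *\<^sub>R M2 s + c3 *\<^sub>R M3 s"
        using p[OF that] by (simp add: algebra_simps)
      then show ?thesis
        using frame that by (simp add: inner_add_left inner_add_right inner_commute)
    qed
    then show "\<exists>p. rectifying_curve I (\<lambda>s. \<alpha> s - p) M1 M2 M3"
      using translate by blast
  qed
qed

end
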